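(* Let $\mathcal E,\mathcal G$ be Hilbert spaces and let $F:[B(\mathcal H)^n]_1\to B(\mathcal H)\bar\otimes_{min}B(\mathcal E,\mathcal G)$ be a bounded free holomorphic function with $\|F(0)\|<\|F\|_\infty$. Then there is no $X_0\in[B(\mathcal H)^n]_1$ such that $\|F(X_0)\|=\|F\|_\infty$.
   Context: $\mathcal H$ is a separable infinite dimensional Hilbert space and $n\in\{1,2,\dots\}\cup\{\infty\}$. For $X=(X_1,\dots,X_n)\in B(\mathcal H)^n$, $\|X\|=\|\sum_iX_iX_i^*\|^{1/2}$, and $[B(\mathcal H)^n]_1=\{X:\|X\|<1\}$. $\mathbb F_n^+$ is the unital free semigroup on $g_1,\dots,g_n$; for $\alpha=g_{i_1}\cdots g_{i_k}$ put $|\alpha|=k$, $X_\alpha=X_{i_1}\cdots X_{i_k}$ ($X_\alpha=I$ for the neutral element, of length $0$). A free holomorphic function on $[B(\mathcal H)^n]_1$ with coefficients in $B(\mathcal E,\mathcal G)$ is a map $F(X)=\sum_{k=0}^\infty\sum_{|\alpha|=k}X_\alpha\otimes A_{(\alpha)}$ with $A_{(\alpha)}\in B(\mathcal E,\mathcal G)$, the series in $k$ converging in operator norm for all $X\in[B(\mathcal H)^n]_1$; $B(\mathcal H)\bar\otimes_{min}B(\mathcal E,\mathcal G)$ is the spatial (minimal) tensor product. $\|F\|_\infty=\sup_{\|X\|<1}\|F(X)\|$, and $F$ is bounded if this is finite. *)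

theory Defs
  imports "HOL-Analysis.Analysis"
begin

section \<open>Complex Hilbert spaces and bounded operators\<close>

text \<open>The inner product is linear in the first argument. Positivity and definiteness are part of
  the last axiom, because the norm of a real normed space has these properties.\<close>

class chilbert_space = banach +
  fixes scaleC :: "complex \<Rightarrow> 'a \<Rightarrow> 'a" (infixr \<open>*\<^sub>C\<close> 75)
    and cinner :: "'a \<Rightarrow> 'a \<Rightarrow> complex"
  assumes scaleC_add_right: "c *\<^sub>C (x + y) = c *\<^sub>C x + c *\<^sub>C y"
    and scaleC_add_left: "(c + d) *\<^sub>C x = c *\<^sub>C x + d *\<^sub>C x"
    and scaleC_scaleC: "c *\<^sub>C (d *\<^sub>C x) = (c * d) *\<^sub>C x"
    and scaleR_scaleC: "r *\<^sub>R x = complex_of_real r *\<^sub>C x"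
    and cinner_commute: "cinner x y = cnj (cinner y x)"
    and cinner_add_left: "cinner (x + y) z = cinner x z + cinner y z"
    and cinner_scaleC_left: "cinner (c *\<^sub>C x) y = c * cinner x y"
    and cinner_self: "cinner x x = complex_of_real ((norm x)\<^sup>2)"

text \<open>The space \<open>B(E, G)\<close>: complex linear operators inside the type of bounded real linear
  operators, whose norm is the usual operator norm.\<close>

definition bop :: "('e::chilbert_space \<Rightarrow>\<^sub>L 'g::chilbert_space) set"
  where "bop = {T. \<forall>c x. blinfun_apply T (c *\<^sub>C x) = c *\<^sub>C blinfun_apply T x}"

definition adj :: "('e::chilbert_space \<Rightarrow>\<^sub>L 'g::chilbert_space) \<Rightarrow> ('g \<Rightarrow>\<^sub>L 'e)"
  where "adj T = (THE S. \<forall>x y. cinner (blinfun_apply T x) y = cinner x (blinfun_apply S y))"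

definition separable_hilbert :: "'h::chilbert_space itself \<Rightarrow> bool"
  where "separable_hilbert _ \<longleftrightarrow> (\<exists>D :: 'h set. countable D \<and> closure D = UNIV)"

text \<open>\<open>span\<close> is the real span; a complex space has finite dimension over the complex numbers
  iff it has finite dimension over the reals.\<close>

definition infinite_dimensional :: "'h::chilbert_space itself \<Rightarrow> bool"
  where "infinite_dimensional _ \<longleftrightarrow> \<not> (\<exists>B :: 'h set. finite B \<and> span B = UNIV)"

text \<open>Unordered sums of operators in the strong operator topology. Over a finite index set
  this is the ordinary finite sum.\<close>

definition sot_has_sum ::
    "('i \<Rightarrow> ('e::real_normed_vector \<Rightarrow>\<^sub>L 'g::real_normed_vector)) \<Rightarrow> ('e \<Rightarrow>\<^sub>L 'g) \<Rightarrow> 'i set \<Rightarrow> bool"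
  where "sot_has_sum f S I \<longleftrightarrow>
    (\<forall>x. ((\<lambda>i. blinfun_apply (f i) x) has_sum blinfun_apply S x) I)"

definition sot_summable ::
    "('i \<Rightarrow> ('e::real_normed_vector \<Rightarrow>\<^sub>L 'g::real_normed_vector)) \<Rightarrow> 'i set \<Rightarrow> bool"
  where "sot_summable f I \<longleftrightarrow> (\<exists>S. sot_has_sum f S I)"

definition sot_sum ::
    "('i \<Rightarrow> ('e::real_normed_vector \<Rightarrow>\<^sub>L 'g::real_normed_vector)) \<Rightarrow> 'i set \<Rightarrow> ('e \<Rightarrow>\<^sub>L 'g)"
  where "sot_sum f I = (THE S. sot_has_sum f S I)"


section \<open>The noncommutative ball\<close>

text \<open>An \<open>n\<close>-tuple of operators is a family indexed by a type \<open>'n::countable\<close>. Such a type is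
  nonempty and is finite or countably infinite, so \<open>n\<close> ranges over the positive integers and
  infinity. Elements of the free semigroup are lists over \<open>'n\<close>.\<close>

definition row_norm :: "('n::countable \<Rightarrow> ('h::chilbert_space \<Rightarrow>\<^sub>L 'h)) \<Rightarrow> real"
  where "row_norm X = sqrt (norm (sot_sum (\<lambda>i. X i o\<^sub>L adj (X i)) UNIV))"

definition row_ball :: "('n::countable \<Rightarrow> ('h::chilbert_space \<Rightarrow>\<^sub>L 'h)) set"
  where "row_ball = {X. (\<forall>i. X i \<in> bop) \<and> sot_summable (\<lambda>i. X i o\<^sub>L adj (X i)) UNIV \<and> row_norm X < 1}"

primrec word_op :: "('n \<Rightarrow> ('h::chilbert_space \<Rightarrow>\<^sub>L 'h)) \<Rightarrow> 'n list \<Rightarrow> ('h \<Rightarrow>\<^sub>L 'h)"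
  where
    "word_op X [] = id_blinfun"
  | "word_op X (i # \<alpha>) = X i o\<^sub>L word_op X \<alpha>"


section \<open>Tensor products\<close>

text \<open>\<open>hilbert_tensor t\<close>: the Hilbert space \<open>'k\<close>, with \<open>t h e\<close> in the role of the elementary
  tensor of \<open>h\<close> and \<open>e\<close>, is a Hilbert space tensor product of \<open>'h\<close> and \<open>'e\<close>. This determines
  \<open>'k\<close> and \<open>t\<close> up to a unique unitary operator. The elementary tensors are closed under complex
  scaling, so their real span is their complex span.\<close>

definition hilbert_tensor ::
    "('h::chilbert_space \<Rightarrow> 'e::chilbert_space \<Rightarrow> 'k::chilbert_space) \<Rightarrow> bool"
  where "hilbert_tensor t \<longleftrightarrow>
    (\<forall>h h' e. t (h + h') e = t h e + t h' e) \<and>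
    (\<forall>h e e'. t h (e + e') = t h e + t h e') \<and>
    (\<forall>c h e. t (c *\<^sub>C h) e = c *\<^sub>C t h e \<and> t h (c *\<^sub>C e) = c *\<^sub>C t h e) \<and>
    (\<forall>h h' e e'. cinner (t h e) (t h' e') = cinner h h' * cinner e e') \<and>
    closure (span {t h e | h e. True}) = UNIV"

text \<open>The operator \<open>T \<otimes> A\<close>, with respect to tensor products \<open>tE\<close> and \<open>tG\<close> of \<open>'h\<close>
  with \<open>'e\<close> and with \<open>'g\<close>.\<close>

definition tensor_op ::
    "('h::chilbert_space \<Rightarrow> 'e::chilbert_space \<Rightarrow> 'he::chilbert_space) \<Rightarrow>
     ('h \<Rightarrow> 'g::chilbert_space \<Rightarrow> 'hg::chilbert_space) \<Rightarrow>
     ('h \<Rightarrow>\<^sub>L 'h) \<Rightarrow> ('e \<Rightarrow>\<^sub>L 'g) \<Rightarrow> ('he \<Rightarrow>\<^sub>L 'hg)"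
  where "tensor_op tE tG T A =
    (THE S. \<forall>h e. blinfun_apply S (tE h e) = tG (blinfun_apply T h) (blinfun_apply A e))"

text \<open>The spatial tensor product of \<open>B(H)\<close> and \<open>B(E, G)\<close>. The real span is again the
  complex one.\<close>

definition min_tensor ::
    "('h::chilbert_space \<Rightarrow> 'e::chilbert_space \<Rightarrow> 'he::chilbert_space) \<Rightarrow>
     ('h \<Rightarrow> 'g::chilbert_space \<Rightarrow> 'hg::chilbert_space) \<Rightarrow> ('he \<Rightarrow>\<^sub>L 'hg) set"
  where "min_tensor tE tG = closure (span {tensor_op tE tG T A | T A. T \<in> bop \<and> A \<in> bop})"


section \<open>Free holomorphic functions\<close>

text \<open>For infinitely many variables the homogeneous part of degree \<open>k\<close> is an infinite sum; it is
  taken in the strong operator topology. The series of homogeneous parts converges in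
  operator norm. Values of \<open>F\<close> outside the ball are irrelevant.\<close>

definition free_holomorphic ::
    "('h::chilbert_space \<Rightarrow> 'e::chilbert_space \<Rightarrow> 'he::chilbert_space) \<Rightarrow>
     ('h \<Rightarrow> 'g::chilbert_space \<Rightarrow> 'hg::chilbert_space) \<Rightarrow>
     (('n::countable \<Rightarrow> ('h \<Rightarrow>\<^sub>L 'h)) \<Rightarrow> ('he \<Rightarrow>\<^sub>L 'hg)) \<Rightarrow> bool"
  where "free_holomorphic tE tG F \<longleftrightarrow>
    (\<forall>X\<in>row_ball. F X \<in> min_tensor tE tG) \<and>
    (\<exists>A. (\<forall>\<alpha>. A \<alpha> \<in> bop) \<and>
      (\<forall>X\<in>row_ball. \<exists>P.
        (\<forall>k. sot_has_sum (\<lambda>\<alpha>. tensor_op tE tG (word_op X \<alpha>) (A \<alpha>)) (P k) {\<alpha>. length \<alpha> = k}) \<and>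
        P sums F X))"

definition bounded_on_ball ::
    "(('n::countable \<Rightarrow> ('h::chilbert_space \<Rightarrow>\<^sub>L 'h)) \<Rightarrow> 'b::real_normed_vector) \<Rightarrow> bool"
  where "bounded_on_ball F \<longleftrightarrow> bdd_above ((\<lambda>X. norm (F X)) ` row_ball)"

definition sup_norm ::
    "(('n::countable \<Rightarrow> ('h::chilbert_space \<Rightarrow>\<^sub>L 'h)) \<Rightarrow> 'b::real_normed_vector) \<Rightarrow> real"
  where "sup_norm F = (SUP X\<in>row_ball. norm (F X))"

end

theory Submission
  imports Defs "HOL-Complex_Analysis.Conformal_Mappings"
begin

text \<open>Suppose that \<open>X\<close> lies in the ball and that \<open>\<parallel>F(X)\<parallel> = \<parallel>F\<parallel>\<^sub>\<infinity>\<close>. The row norm is homogeneous,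
  so \<open>z X\<close> stays in the ball for all complex \<open>z\<close> in a disc of some radius \<open>R > 1\<close>. On this disc
  \<open>g(z) = F(z X)\<close> is a power series \<open>\<Sum> z\<^sup>k Q\<^sub>k\<close> whose coefficients are the homogeneous parts of
  \<open>F\<close> at \<open>X\<close>. It is bounded by \<open>\<parallel>F\<parallel>\<^sub>\<infinity>\<close>, with \<open>g(0) = F(0)\<close> and \<open>g(1) = F(X)\<close>. So the theorem
  is the maximum principle for operator-valued functions of one variable.

  That principle (\<open>operator_power_series_maximum\<close>) follows from a quantitative scalar one. By the
  Schwarz lemma, a scalar function on the disc that is bounded by \<open>M\<close> and is at most \<open>m < M\<close> in
  modulus at \<open>0\<close> is bounded at \<open>1\<close> by a number below \<open>M\<close> that depends only on \<open>M\<close>, \<open>m\<close> and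
  \<open>R\<close> (\<open>schwarz_pick_gap\<close>). Applied to all coefficients \<open>\<langle>g(z) x, y\<rangle>\<close> with unit vectors, this
  bounds \<open>\<parallel>g(1)\<parallel>\<close> away from \<open>\<parallel>F\<parallel>\<^sub>\<infinity>\<close>.

  The remaining work justifies \<open>F(z X) = \<Sum> z\<^sup>k Q\<^sub>k\<close>. The adjoint and the operator \<open>T \<otimes> A\<close> are
  given by definite descriptions, which can be computed with only if such operators exist. Adjoints
  exist by the Riesz representation theorem (\<open>riesz_representation_real\<close>); \<open>T \<otimes> A\<close> exists
  because \<open>h \<otimes> e \<mapsto> T h \<otimes> A e\<close> is bounded on finite sums of elementary tensors
  (\<open>tensor_op_apply\<close>), which becomes visible once the second factors are made orthogonal
  (\<open>orthogonal_rewriting\<close>).\<close>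


section \<open>Complex Hilbert spaces\<close>

lemma scaleC_zero_left [simp]: "0 *\<^sub>C x = (0::'a::chilbert_space)"
  using scaleC_add_left[of 0 0 x] by simp

lemma scaleC_zero_right [simp]: "c *\<^sub>C (0::'a::chilbert_space) = 0"
  using scaleC_add_right[of c 0 0] by simp

lemma scaleC_one [simp]: "1 *\<^sub>C x = (x::'a::chilbert_space)"
  using scaleR_scaleC[of 1 x] by simp

lemma cinner_add_right: "cinner x (y + z) = cinner x y + cinner x (z::'a::chilbert_space)"
  by (metis cinner_commute cinner_add_left complex_cnj_add)

lemma cinner_scaleC_right: "cinner x (c *\<^sub>C y) = cnj c * cinner x (y::'a::chilbert_space)"
  by (metis cinner_commute cinner_scaleC_left complex_cnj_mult)

lemma cinner_zero_left [simp]: "cinner 0 (y::'a::chilbert_space) = 0"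
  using cinner_add_left[of 0 0 y] by simp

lemma cinner_zero_right [simp]: "cinner (y::'a::chilbert_space) 0 = 0"
  using cinner_add_right[of y 0 0] by simp

lemma cinner_minus_left: "cinner (- x) (y::'a::chilbert_space) = - cinner x y"
  using cinner_add_left[of x "- x" y] by (simp add: add_eq_0_iff)

lemma cinner_minus_right: "cinner x (- y::'a::chilbert_space) = - cinner x y"
  using cinner_add_right[of x y "- y"] by (simp add: add_eq_0_iff)

lemma cinner_diff_left: "cinner (x - y) (z::'a::chilbert_space) = cinner x z - cinner y z"
  using cinner_add_left[of x "- y" z] by (simp add: cinner_minus_left)

lemma cinner_diff_right: "cinner z (x - y::'a::chilbert_space) = cinner z x - cinner z y"
  using cinner_add_right[of z x "- y"] by (simp add: cinner_minus_right)

lemma cinner_sum_left: "cinner (\<Sum>i\<in>I. f i) (y::'a::chilbert_space) = (\<Sum>i\<in>I. cinner (f i) y)"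
  by (induction I rule: infinite_finite_induct) (auto simp: cinner_add_left)

lemma cinner_sum_right: "cinner (y::'a::chilbert_space) (\<Sum>i\<in>I. f i) = (\<Sum>i\<in>I. cinner y (f i))"
  by (induction I rule: infinite_finite_induct) (auto simp: cinner_add_right)

lemma cinner_scaleR_left: "cinner (r *\<^sub>R x) (y::'a::chilbert_space) = complex_of_real r * cinner x y"
  by (simp add: scaleR_scaleC cinner_scaleC_left)

lemma cinner_scaleR_right: "cinner x (r *\<^sub>R y::'a::chilbert_space) = complex_of_real r * cinner x y"
  by (simp add: scaleR_scaleC cinner_scaleC_right)

lemma norm_scaleC [simp]: "norm (c *\<^sub>C (x::'a::chilbert_space)) = cmod c * norm x"
proof -
  have "complex_of_real ((norm (c *\<^sub>C x))\<^sup>2) = c * cnj c * complex_of_real ((norm x)\<^sup>2)"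
    by (simp add: cinner_self[symmetric] cinner_scaleC_left cinner_scaleC_right del: of_real_power)
  also have "\<dots> = complex_of_real ((cmod c * norm x)\<^sup>2)"
    by (simp add: complex_norm_square[symmetric] power_mult_distrib)
  finally have "(norm (c *\<^sub>C x))\<^sup>2 = (cmod c * norm x)\<^sup>2"
    using of_real_eq_iff by blast
  then show ?thesis by simp
qed

lemma norm_add_squared:
  "(norm (x + y))\<^sup>2 = (norm x)\<^sup>2 + 2 * Re (cinner x y) + (norm (y::'a::chilbert_space))\<^sup>2"
proof -
  have "complex_of_real ((norm (x + y))\<^sup>2)
      = of_real ((norm x)\<^sup>2) + (cinner x y + cnj (cinner x y)) + of_real ((norm y)\<^sup>2)"
    unfolding cinner_self[symmetric] cinner_add_left cinner_add_right cinner_commute[of y x] by simp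
  also have "cinner x y + cnj (cinner x y) = of_real (2 * Re (cinner x y))"
    by (simp add: complex_add_cnj)
  finally show ?thesis
    by (metis of_real_add of_real_eq_iff)
qed

lemma norm_cinner_le: "cmod (cinner x y) \<le> norm x * norm (y::'a::chilbert_space)"
proof (cases "y = 0")
  case False
  define c where "c = - cinner x y / of_real ((norm y)\<^sup>2)"
  have ny: "norm y > 0" using False by simp
  have "cinner x (c *\<^sub>C y) = - (cinner x y * cnj (cinner x y)) / of_real ((norm y)\<^sup>2)"
    by (simp add: c_def cinner_scaleC_right)
  also have "\<dots> = of_real (- (cmod (cinner x y))\<^sup>2 / (norm y)\<^sup>2)"
    by (simp flip: complex_norm_square)
  finally have "Re (cinner x (c *\<^sub>C y)) = - (cmod (cinner x y))\<^sup>2 / (norm y)\<^sup>2"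
    by (simp only: Re_complex_of_real)
  moreover have "(norm (c *\<^sub>C y))\<^sup>2 = (cmod (cinner x y))\<^sup>2 / (norm y)\<^sup>2"
    using ny by (simp add: c_def norm_divide norm_mult norm_power power_mult_distrib power_divide
        field_simps power2_eq_square)
  ultimately have "(norm (x + c *\<^sub>C y))\<^sup>2 = (norm x)\<^sup>2 - (cmod (cinner x y))\<^sup>2 / (norm y)\<^sup>2"
    by (simp add: norm_add_squared)
  moreover have "(norm (x + c *\<^sub>C y))\<^sup>2 \<ge> 0" by simp
  ultimately have "(cmod (cinner x y))\<^sup>2 / (norm y)\<^sup>2 \<le> (norm x)\<^sup>2" by linarith
  then have "(cmod (cinner x y))\<^sup>2 \<le> (norm x * norm y)\<^sup>2"
    using ny by (simp add: divide_le_eq power_mult_distrib)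
  then show ?thesis by (rule power2_le_imp_le) simp
qed auto

lemma bounded_linear_cinner_left: "bounded_linear (\<lambda>x. cinner x (y::'a::chilbert_space))"
  by (rule bounded_linear_intro[where K = "norm y"])
    (auto simp: cinner_add_left cinner_scaleR_left scaleR_conv_of_real norm_cinner_le)

lemma eq_if_Re_cinner_eq:
  assumes "\<And>x. Re (cinner x y) = Re (cinner x (z::'a::chilbert_space))"
  shows "y = z"
proof -
  have "Re (cinner (y - z) (y - z)) = 0"
    using assms[of "y - z"] by (simp add: cinner_diff_right)
  then show ?thesis by (simp add: cinner_self)
qed

text \<open>The energy \<open>\<parallel>x\<parallel>\<^sup>2 - 2 f x\<close> is bounded below, and the parallelogram law makes each
  minimizing sequence Cauchy. At its limit the first variation vanishes, which is the
  representation of \<open>f\<close>.\<close>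

theorem riesz_representation_real:
  fixes f :: "'a::chilbert_space \<Rightarrow> real"
  assumes "bounded_linear f"
  shows "\<exists>m. \<forall>x. f x = Re (cinner x m)"
proof -
  interpret f: bounded_linear f by fact
  define J where "J x = (norm x)\<^sup>2 - 2 * f x" for x
  obtain K where K: "\<And>x. \<bar>f x\<bar> \<le> norm x * K"
    using f.bounded by auto
  have below: "- K\<^sup>2 \<le> J x" for x
  proof -
    have "0 \<le> (norm x - K)\<^sup>2" by simp
    also have "\<dots> = (norm x)\<^sup>2 - 2 * (norm x * K) + K\<^sup>2" by (simp add: power2_diff)
    finally show ?thesis using K[of x] by (simp add: J_def)
  qed
  define I where "I = Inf (range J)"
  have bdd: "bdd_below (range J)" using below by (auto intro!: bdd_belowI)
  have I_le: "I \<le> J x" for x unfolding I_def by (intro cInf_lower bdd) simp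
  have "\<exists>x. J x < I + 1 / real (Suc n)" for n
    using cInf_lessD[of "range J" "I + 1 / real (Suc n)"] by (auto simp: I_def)
  then obtain u where u: "\<And>n. J (u n) < I + 1 / real (Suc n)" by metis
  have par: "J x + J y - 2 * J ((1/2) *\<^sub>R (x + y)) = (norm (x - y))\<^sup>2 / 2" for x y
  proof -
    have "(norm (x - y))\<^sup>2 = (norm x)\<^sup>2 - 2 * Re (cinner x y) + (norm y)\<^sup>2"
      using norm_add_squared[of x "- y"] by (simp add: cinner_minus_right)
    moreover have "(norm ((1/2) *\<^sub>R (x + y)))\<^sup>2 = (norm (x + y))\<^sup>2 / 4"
      by (simp add: power_mult_distrib power2_eq_square)
    ultimately show ?thesis
      by (simp add: J_def f.scaleR f.add norm_add_squared field_simps)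
  qed
  have "Cauchy u"
  proof (rule metric_CauchyI)
    fix e :: real assume "e > 0"
    then obtain N where N: "inverse (real (Suc N)) < e\<^sup>2 / 4"
      using reals_Archimedean[of "e\<^sup>2 / 4"] by auto
    have "dist (u m) (u n) < e" if "m \<ge> N" "n \<ge> N" for m n
    proof -
      have "1 / real (Suc m) \<le> inverse (real (Suc N))" "1 / real (Suc n) \<le> inverse (real (Suc N))"
        using that by (simp_all add: field_simps)
      then have "J (u m) + J (u n) - 2 * J ((1/2) *\<^sub>R (u m + u n)) < e\<^sup>2 / 2"
        using u[of m] u[of n] I_le[of "(1/2) *\<^sub>R (u m + u n)"] N by linarith
      then have "(norm (u m - u n))\<^sup>2 < e\<^sup>2" using par[of "u m" "u n"] by simp
      then show ?thesis using \<open>e > 0\<close> by (simp add: dist_norm power_less_imp_less_base)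
    qed
    then show "\<exists>M. \<forall>m\<ge>M. \<forall>n\<ge>M. dist (u m) (u n) < e" by blast
  qed
  then obtain m where m: "u \<longlonglongrightarrow> m" using Cauchy_convergent convergent_def by blast
  have "(\<lambda>n. J (u n)) \<longlonglongrightarrow> J m"
    unfolding J_def by (intro tendsto_intros m f.tendsto)
  moreover have "(\<lambda>n. I + 1 / real (Suc n)) \<longlonglongrightarrow> I + 0"
    by (intro tendsto_add tendsto_const LIMSEQ_Suc[OF lim_1_over_n])
  ultimately have "J m \<le> I"
    using u by (intro LIMSEQ_le[of "\<lambda>n. J (u n)" _ "\<lambda>n. I + 1 / real (Suc n)"]) (auto intro: less_imp_le)
  then have min: "J m \<le> J x" for x using I_le[of x] by simp
  have "f h = Re (cinner h m)" for h
  proof (rule ccontr)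
    assume ne: "f h \<noteq> Re (cinner h m)"
    define d where "d = f h - Re (cinner h m)"
    have "d \<noteq> 0" using ne by (simp add: d_def)
    have var: "0 \<le> t\<^sup>2 * (norm h)\<^sup>2 - 2 * t * d" for t
    proof -
      have "Re (cinner m h) = Re (cinner h m)" by (subst cinner_commute) simp
      then show ?thesis
        using min[of "m + t *\<^sub>R h"]
        by (simp add: J_def d_def f.add f.scaleR norm_add_squared cinner_scaleR_right
            power_mult_distrib algebra_simps)
    qed
    have pos: "(norm h)\<^sup>2 + 1 > 0" by (simp add: add_nonneg_pos)
    \<comment> \<open>a step small enough for the linear term to dominate the quadratic one\<close>
    define t where "t = d / ((norm h)\<^sup>2 + 1)"
    have "t\<^sup>2 * ((norm h)\<^sup>2 + 1) = t * d" using pos by (simp add: t_def power2_eq_square)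
    then have "0 \<le> - t\<^sup>2 - t * d" using var[of t] by (simp add: algebra_simps)
    moreover have "t * d > 0" using \<open>d \<noteq> 0\<close> pos by (simp add: t_def zero_less_mult_iff flip: power2_eq_square)
    ultimately show False by (smt (verit) zero_le_power2)
  qed
  then show ?thesis by blast
qed


section \<open>Complex scalars and adjoints\<close>

definition scaleC_op :: "complex \<Rightarrow> ('a::chilbert_space \<Rightarrow>\<^sub>L 'a)"
  where "scaleC_op c = Blinfun (\<lambda>x. c *\<^sub>C x)"

lemma scaleC_op_apply [simp]: "blinfun_apply (scaleC_op c) x = c *\<^sub>C x"
proof -
  have "bounded_linear (\<lambda>x::'a. c *\<^sub>C x)"
    by (rule bounded_linear_intro[where K = "cmod c"])
      (simp_all add: scaleC_add_right scaleR_scaleC scaleC_scaleC mult.commute[of "complex_of_real _"]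
        mult.commute[of "cmod c"])
  then show ?thesis by (simp add: scaleC_op_def bounded_linear_Blinfun_apply)
qed

lemma bopD: "T \<in> bop \<Longrightarrow> blinfun_apply T (c *\<^sub>C x) = c *\<^sub>C blinfun_apply T x"
  by (simp add: bop_def)

lemma scaleC_op_bop: "T \<in> bop \<Longrightarrow> scaleC_op c o\<^sub>L T \<in> bop"
  by (simp add: bop_def scaleC_scaleC mult.commute)

lemma word_op_bop: "(\<And>i. X i \<in> bop) \<Longrightarrow> word_op X \<alpha> \<in> bop"
  by (induction \<alpha>) (auto simp: bop_def)

lemma word_op_scaleC:
  assumes "\<And>i. X i \<in> bop"
  shows "word_op (\<lambda>i. scaleC_op c o\<^sub>L X i) \<alpha> = scaleC_op (c ^ length \<alpha>) o\<^sub>L word_op X \<alpha>"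
proof (induction \<alpha>)
  case (Cons i \<alpha>)
  then show ?case
    using assms[of i] by (auto intro!: blinfun_eqI simp: bopD scaleC_scaleC)
qed (auto intro!: blinfun_eqI)

text \<open>A real representing vector suffices: replacing \<open>x\<close> by \<open>\<i> x\<close> recovers the imaginary part,
  because \<open>T\<close> is complex linear.\<close>

lemma adj_exists:
  fixes T :: "'e::chilbert_space \<Rightarrow>\<^sub>L 'g::chilbert_space"
  assumes "T \<in> bop"
  shows "\<exists>S. \<forall>x y. cinner (blinfun_apply T x) y = cinner x (blinfun_apply S y)"
proof -
  have "bounded_linear (\<lambda>x. Re (cinner (blinfun_apply T x) y))" for y
    by (intro bounded_linear_compose[OF bounded_linear_Re]
        bounded_linear_compose[OF bounded_linear_cinner_left] blinfun.bounded_linear_right)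
  then have "\<exists>m. \<forall>x. Re (cinner (blinfun_apply T x) y) = Re (cinner x m)" for y
    by (rule riesz_representation_real)
  then obtain m where m: "\<And>x y. Re (cinner (blinfun_apply T x) y) = Re (cinner x (m y))"
    by metis
  have full: "cinner (blinfun_apply T x) y = cinner x (m y)" for x y
    using m[of x y] m[of "\<i> *\<^sub>C x" y] assms
    by (auto simp: complex_eq_iff cinner_scaleC_left bopD)
  have "bounded_linear m"
  proof (rule bounded_linear_intro[where K = "norm T"])
    show "m (x + y) = m x + m y" for x y
      by (rule eq_if_Re_cinner_eq) (simp add: cinner_add_right flip: full)
    show "m (r *\<^sub>R x) = r *\<^sub>R m x" for r x
      by (rule eq_if_Re_cinner_eq) (simp add: cinner_scaleR_right flip: full)
    show "norm (m y) \<le> norm y * norm T" for y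
    proof (cases "m y = 0")
      case False
      have "(norm (m y))\<^sup>2 = Re (cinner (blinfun_apply T (m y)) y)"
        by (simp add: m cinner_self del: of_real_power)
      also have "\<dots> \<le> norm (blinfun_apply T (m y)) * norm y"
        using complex_Re_le_cmod norm_cinner_le order_trans by blast
      also have "\<dots> \<le> norm T * norm (m y) * norm y"
        by (intro mult_right_mono norm_blinfun) simp
      finally show ?thesis using False by (simp add: power2_eq_square mult.commute mult.left_commute)
    qed simp
  qed
  then show ?thesis
    using full by (intro exI[of _ "Blinfun m"]) (simp add: bounded_linear_Blinfun_apply)
qed

lemma adj_eqI:
  assumes "\<And>x y. cinner (blinfun_apply T x) y = cinner x (blinfun_apply S y)"
  shows "adj T = S"
  unfolding adj_def
proof (rule the_equality)
  fix S' assume *: "\<forall>x y. cinner (blinfun_apply T x) y = cinner x (blinfun_apply S' y)"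
  show "S' = S"
    by (rule blinfun_eqI, rule eq_if_Re_cinner_eq) (metis * assms)
qed (use assms in blast)

lemma cinner_adj:
  assumes "T \<in> bop"
  shows "cinner (blinfun_apply T x) y = cinner x (blinfun_apply (adj T) y)"
proof -
  obtain S where S: "\<And>x y. cinner (blinfun_apply T x) y = cinner x (blinfun_apply S y)"
    using adj_exists[OF assms] by blast
  then show ?thesis by (simp add: adj_eqI[OF S])
qed

lemma adj_scaleC_op:
  assumes "T \<in> bop"
  shows "adj (scaleC_op c o\<^sub>L T) = scaleC_op (cnj c) o\<^sub>L adj T"
  by (rule adj_eqI) (simp add: cinner_scaleC_left cinner_scaleC_right cinner_adj[OF assms])

lemma scaleC_op_self_adj:
  assumes "T \<in> bop"
  shows "(scaleC_op c o\<^sub>L T) o\<^sub>L adj (scaleC_op c o\<^sub>L T) = (cmod c)\<^sup>2 *\<^sub>R (T o\<^sub>L adj T)"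
proof (rule blinfun_eqI)
  fix x
  show "blinfun_apply ((scaleC_op c o\<^sub>L T) o\<^sub>L adj (scaleC_op c o\<^sub>L T)) x
      = blinfun_apply ((cmod c)\<^sup>2 *\<^sub>R (T o\<^sub>L adj T)) x"
    by (simp add: adj_scaleC_op assms bopD[OF assms] scaleC_scaleC scaleR_scaleC blinfun.scaleR_left
        complex_norm_square[symmetric] del: of_real_power)
qed


section \<open>Discs in the noncommutative ball\<close>

lemma sot_has_sum_unique:
  assumes "sot_has_sum f S I" "sot_has_sum f S' I"
  shows "S = S'"
proof (rule blinfun_eqI)
  show "blinfun_apply S x = blinfun_apply S' x" for x
    using assms unfolding sot_has_sum_def by (intro has_sum_unique) auto
qed

lemma sot_sum_eqI: "sot_has_sum f S I \<Longrightarrow> sot_sum f I = S"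
  unfolding sot_sum_def by (auto intro: sot_has_sum_unique)

lemma sot_has_sum_cong:
  assumes "\<And>i. i \<in> I \<Longrightarrow> f i = g i"
  shows "sot_has_sum f S I \<longleftrightarrow> sot_has_sum g S I"
proof -
  have "((\<lambda>i. blinfun_apply (f i) x) has_sum y) I \<longleftrightarrow> ((\<lambda>i. blinfun_apply (g i) x) has_sum y) I" for x y
    using assms by (intro has_sum_cong) simp
  then show ?thesis by (simp add: sot_has_sum_def)
qed

lemma sot_has_sum_compose_left:
  assumes "sot_has_sum f S I"
  shows "sot_has_sum (\<lambda>i. L o\<^sub>L f i) (L o\<^sub>L S) I"
  unfolding sot_has_sum_def
proof
  show "((\<lambda>i. blinfun_apply (L o\<^sub>L f i) x) has_sum blinfun_apply (L o\<^sub>L S) x) I" for x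
    using has_sum_bounded_linear[OF blinfun.bounded_linear_right[of L],
        where f = "\<lambda>i. blinfun_apply (f i) x"] assms
    by (simp add: sot_has_sum_def)
qed

lemma sot_has_sum_scaleR:
  assumes "sot_has_sum f S I"
  shows "sot_has_sum (\<lambda>i. r *\<^sub>R f i) (r *\<^sub>R S) I"
  unfolding sot_has_sum_def
proof
  show "((\<lambda>i. blinfun_apply (r *\<^sub>R f i) x) has_sum blinfun_apply (r *\<^sub>R S) x) I" for x
    using has_sum_bounded_linear[OF bounded_linear_scaleR_right[of r],
        where f = "\<lambda>i. blinfun_apply (f i) x"] assms
    by (simp add: sot_has_sum_def blinfun.scaleR_left)
qed

text \<open>The adjoint contributes the conjugate scalar, so the row norm is multiplied by \<open>\<bar>c\<bar>\<close>.\<close>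

lemma row_ball_scaleC:
  assumes X: "X \<in> row_ball" and c: "cmod c * row_norm X < 1"
  shows "(\<lambda>i. scaleC_op c o\<^sub>L X i) \<in> row_ball"
proof -
  have bop: "X i \<in> bop" for i using X by (simp add: row_ball_def)
  obtain S where S: "sot_has_sum (\<lambda>i. X i o\<^sub>L adj (X i)) S UNIV"
    using X by (auto simp: row_ball_def sot_summable_def)
  let ?Y = "\<lambda>i. scaleC_op c o\<^sub>L X i"
  have Y: "sot_has_sum (\<lambda>i. ?Y i o\<^sub>L adj (?Y i)) ((cmod c)\<^sup>2 *\<^sub>R S) UNIV"
    unfolding scaleC_op_self_adj[OF bop] by (rule sot_has_sum_scaleR[OF S])
  have "row_norm ?Y = cmod c * row_norm X"
    unfolding row_norm_def sot_sum_eqI[OF S] sot_sum_eqI[OF Y] by (simp add: real_sqrt_mult)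
  then show ?thesis
    using c Y bop by (auto simp: row_ball_def sot_summable_def scaleC_op_bop)
qed


section \<open>Tensor products of operators\<close>

lemma dense_bounded_linear_extension:
  fixes f :: "'a::real_normed_vector \<Rightarrow> 'b::banach"
  assumes S: "subspace S" and dense: "closure S = UNIV"
    and add: "\<And>x y. x \<in> S \<Longrightarrow> y \<in> S \<Longrightarrow> f (x + y) = f x + f y"
    and scale: "\<And>r x. x \<in> S \<Longrightarrow> f (r *\<^sub>R x) = r *\<^sub>R f x"
    and bound: "\<And>x. x \<in> S \<Longrightarrow> norm (f x) \<le> K * norm x"
  obtains g :: "'a \<Rightarrow>\<^sub>L 'b" where "\<And>x. x \<in> S \<Longrightarrow> blinfun_apply g x = f x"
proof -
  have diff: "f (x - y) = f x - f y" if "x \<in> S" "y \<in> S" for x y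
    using add[of x "(-1) *\<^sub>R y"] scale[of y "-1"] that S by (simp add: subspace_neg)
  have "dist (f x) (f y) \<le> max K 0 * dist x y" if "x \<in> S" "y \<in> S" for x y
  proof -
    have "dist (f x) (f y) \<le> K * dist x y"
      using bound[of "x - y"] diff[of x y] that S by (simp add: dist_norm subspace_diff)
    also have "\<dots> \<le> max K 0 * dist x y" by (intro mult_right_mono) auto
    finally show ?thesis .
  qed
  then have "(max K 0)-lipschitz_on S f" by (intro lipschitz_onI) auto
  then obtain g where g: "uniformly_continuous_on UNIV g" "\<And>x. x \<in> S \<Longrightarrow> f x = g x"
    using uniformly_continuous_on_extension_on_closure[OF lipschitz_on_uniformly_continuous] dense
    by metis
  then have cont: "continuous_on UNIV g" by (simp add: uniformly_continuous_imp_continuous)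
  have lim: "(\<lambda>n. g (u n)) \<longlonglongrightarrow> g x" if "u \<longlonglongrightarrow> x" for u x
    using continuous_on_tendsto_compose[OF cont that] by simp
  have approx: "\<exists>u. (\<forall>n. u n \<in> S) \<and> u \<longlonglongrightarrow> x" for x
    using dense closure_sequential[of x S] by auto
  have "bounded_linear g"
  proof (rule bounded_linear_intro[where K = K])
    fix x y and r :: real
    obtain u where u: "\<And>n. u n \<in> S" "u \<longlonglongrightarrow> x" using approx by blast
    obtain v where v: "\<And>n. v n \<in> S" "v \<longlonglongrightarrow> y" using approx by blast
    have "(\<lambda>n. g (u n + v n)) \<longlonglongrightarrow> g (x + y)"
      by (intro lim tendsto_add u v)
    moreover have "g (u n + v n) = g (u n) + g (v n)" for n
      using add[of "u n" "v n"] g(2)[of "u n + v n"] g(2)[of "u n"] g(2)[of "v n"] u(1) v(1)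
        subspace_add[OF S] by simp
    ultimately have "(\<lambda>n. g (u n) + g (v n)) \<longlonglongrightarrow> g (x + y)" by simp
    then show "g (x + y) = g x + g y"
      using LIMSEQ_unique tendsto_add[OF lim[OF u(2)] lim[OF v(2)]] by blast
    have "(\<lambda>n. g (r *\<^sub>R u n)) \<longlonglongrightarrow> g (r *\<^sub>R x)"
      by (intro lim tendsto_scaleR tendsto_const u)
    moreover have "g (r *\<^sub>R u n) = r *\<^sub>R g (u n)" for n
      using scale[of "u n" r] g(2)[of "r *\<^sub>R u n"] g(2)[of "u n"] u(1) subspace_scale[OF S] by simp
    ultimately have "(\<lambda>n. r *\<^sub>R g (u n)) \<longlonglongrightarrow> g (r *\<^sub>R x)" by simp
    then show "g (r *\<^sub>R x) = r *\<^sub>R g x"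
      using LIMSEQ_unique tendsto_scaleR[OF tendsto_const lim[OF u(2)]] by blast
    have "norm (g (u n)) \<le> norm (u n) * K" for n
      using bound[OF u(1)] g(2)[OF u(1)] by (simp add: mult.commute)
    then show "norm (g x) \<le> norm x * K"
      by (intro LIMSEQ_le[OF tendsto_norm[OF lim[OF u(2)]] tendsto_mult[OF tendsto_norm[OF u(2)] tendsto_const]])
        auto
  qed
  then show thesis
    using g(2) by (intro that[of "Blinfun g"]) (simp add: bounded_linear_Blinfun_apply)
qed

text \<open>The bound makes the value of the extension on a linear combination independent of the way in which the
  combination is written.\<close>

lemma bounded_linear_by_generators:
  fixes v :: "'i \<Rightarrow> 'a::real_normed_vector" and w :: "'i \<Rightarrow> 'b::banach"
  assumes dense: "closure (span (range v)) = UNIV"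
    and bound: "\<And>l. norm (\<Sum>(r, i)\<leftarrow>l. r *\<^sub>R w i) \<le> K * norm (\<Sum>(r, i)\<leftarrow>l. r *\<^sub>R v i)"
  obtains g :: "'a \<Rightarrow>\<^sub>L 'b" where "\<And>i. blinfun_apply g (v i) = w i"
proof -
  define V where "V l = (\<Sum>(r, i)\<leftarrow>l. r *\<^sub>R v i)" for l :: "(real \<times> 'i) list"
  define W where "W l = (\<Sum>(r, i)\<leftarrow>l. r *\<^sub>R w i)" for l :: "(real \<times> 'i) list"
  define scale where "scale c l = map (\<lambda>(r, i). (c * r, i)) l" for c :: real and l :: "(real \<times> 'i) list"
  have V_app: "V (l @ l') = V l + V l'" and W_app: "W (l @ l') = W l + W l'" for l l'
    by (simp_all add: V_def W_def)
  have V_scale: "V (scale c l) = c *\<^sub>R V l" and W_scale: "W (scale c l) = c *\<^sub>R W l" for c l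
    by (induction l) (auto simp: V_def W_def scale_def scaleR_add_right)
  have W_bound: "norm (W l) \<le> K * norm (V l)" for l
    using bound by (simp add: V_def W_def)
  have wd: "W l = W l'" if "V l = V l'" for l l'
    using W_bound[of "l @ scale (-1) l'"] that by (simp add: V_app W_app V_scale W_scale)
  define f where "f x = W (SOME l. V l = x)" for x
  have f_V: "f (V l) = W l" for l
    unfolding f_def by (rule wd) (rule someI[of "\<lambda>l'. V l' = V l"], rule refl)
  have sub: "subspace (range V)"
  proof (rule subspaceI)
    show "0 \<in> range V" by (rule range_eqI[of _ _ "[]"]) (simp add: V_def)
    show "x + y \<in> range V" if "x \<in> range V" "y \<in> range V" for x y
      using that by (auto simp flip: V_app)
    show "c *\<^sub>R x \<in> range V" if "x \<in> range V" for c x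
      using that by (auto simp flip: V_scale)
  qed
  have v_in: "v i = V [(1, i)]" for i by (simp add: V_def)
  then have "range v \<subseteq> range V" by auto
  then have "span (range v) \<subseteq> range V" using sub by (rule span_minimal)
  then have dense_V: "closure (range V) = UNIV" using dense closure_mono by blast
  have f_add: "f (x + y) = f x + f y" if "x \<in> range V" "y \<in> range V" for x y
    using that by (auto simp: f_V W_app simp flip: V_app)
  have f_scale: "f (c *\<^sub>R x) = c *\<^sub>R f x" if "x \<in> range V" for c x
    using that by (auto simp: f_V W_scale simp flip: V_scale)
  have f_bound: "norm (f x) \<le> K * norm x" if "x \<in> range V" for x
    using that by (auto simp: f_V W_bound)
  obtain g :: "'a \<Rightarrow>\<^sub>L 'b" where g: "\<And>x. x \<in> range V \<Longrightarrow> blinfun_apply g x = f x"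
    using dense_bounded_linear_extension[of "range V" f K, OF sub dense_V f_add f_scale f_bound] by blast
  have "blinfun_apply g (v i) = w i" for i
    using g[OF rangeI, of "[(1, i)]"] f_V[of "[(1, i)]"] by (simp add: v_in[symmetric]) (simp add: W_def)
  then show thesis by (rule that)
qed

definition complex_bilinear ::
    "('h::chilbert_space \<Rightarrow> 'e::chilbert_space \<Rightarrow> 'k::chilbert_space) \<Rightarrow> bool"
  where "complex_bilinear t \<longleftrightarrow>
    (\<forall>h h' e. t (h + h') e = t h e + t h' e) \<and>
    (\<forall>h e e'. t h (e + e') = t h e + t h e') \<and>
    (\<forall>c h e. t (c *\<^sub>C h) e = c *\<^sub>C t h e \<and> t h (c *\<^sub>C e) = c *\<^sub>C t h e)"

lemma complex_bilinear_simps: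
  assumes "complex_bilinear t"
  shows "t (h + h') e = t h e + t h' e" "t h (e + e') = t h e + t h e'"
    "t (c *\<^sub>C h) e = c *\<^sub>C t h e" "t h (c *\<^sub>C e) = c *\<^sub>C t h e"
    "t h 0 = 0" "t h (\<Sum>i\<in>I. g i) = (\<Sum>i\<in>I. t h (g i))"
proof -
  show *: "t (h + h') e = t h e + t h' e" "t h (e + e') = t h e + t h e'"
    "t (c *\<^sub>C h) e = c *\<^sub>C t h e" "t h (c *\<^sub>C e) = c *\<^sub>C t h e" for h h' e e' c
    using assms by (auto simp: complex_bilinear_def)
  show zero: "t h 0 = 0" for h using *(2)[of h 0 0] by simp
  show "t h (\<Sum>i\<in>I. g i) = (\<Sum>i\<in>I. t h (g i))"
    by (induction I rule: infinite_finite_induct) (auto simp: * zero)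
qed

lemma hilbert_tensor_bilinear: "hilbert_tensor t \<Longrightarrow> complex_bilinear t"
  unfolding hilbert_tensor_def complex_bilinear_def by blast

lemma hilbert_tensor_swap:
  assumes "hilbert_tensor t"
  shows "hilbert_tensor (\<lambda>e h. t h e)"
proof -
  have "{t h e | e h. True} = {t h e | h e. True}" by auto
  with assms show ?thesis by (simp add: hilbert_tensor_def mult.commute)
qed

text \<open>Gram--Schmidt: bilinearity alone decides how the first arguments change when the second
  ones are made orthogonal, so one rewriting serves two bilinear maps at once.\<close>

lemma orthogonal_rewriting:
  fixes f :: "'h::chilbert_space \<Rightarrow> 'e::chilbert_space \<Rightarrow> 'k::chilbert_space"
    and f' :: "'h \<Rightarrow> 'e \<Rightarrow> 'l::chilbert_space"
  assumes f: "complex_bilinear f" and f': "complex_bilinear f'"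
  shows "\<exists>B u. finite B \<and> pairwise (\<lambda>x y. cinner x y = 0) B \<and>
    (\<Sum>(h, e)\<leftarrow>l. f h e) = (\<Sum>b\<in>B. f (u b) b) \<and>
    (\<Sum>(h, e)\<leftarrow>l. f' h e) = (\<Sum>b\<in>B. f' (u b) b)"
proof (induction l)
  case Nil
  show ?case by (rule exI[of _ "{}"]) simp
next
  case (Cons p l)
  obtain h e where p: "p = (h, e)" by force
  obtain B u where B: "finite B" "pairwise (\<lambda>x y. cinner x y = 0) B"
    and sums: "(\<Sum>(h, e)\<leftarrow>l. f h e) = (\<Sum>b\<in>B. f (u b) b)"
      "(\<Sum>(h, e)\<leftarrow>l. f' h e) = (\<Sum>b\<in>B. f' (u b) b)"
    using Cons.IH by blast
  \<comment> \<open>for \<open>b = 0\<close> the quotient is \<open>0\<close>, so that \<open>0\<close> may belong to \<open>B\<close>\<close>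
  define c where "c b = cinner e b / cinner b b" for b
  define e' where "e' = e - (\<Sum>b\<in>B. c b *\<^sub>C b)"
  define u' where "u' b = u b + c b *\<^sub>C h" for b
  have orth: "cinner e' b = 0" if "b \<in> B" for b
  proof -
    have "(\<Sum>b'\<in>B. c b' * cinner b' b) = (\<Sum>b'\<in>B. if b' = b then c b * cinner b b else 0)"
      using B(2) that by (intro sum.cong) (auto simp: pairwise_def)
    also have "\<dots> = cinner e b"
      using B(1) that by (cases "b = 0") (auto simp: c_def cinner_self)
    finally show ?thesis
      by (simp add: e'_def cinner_diff_left cinner_sum_left cinner_scaleC_left)
  qed
  have e: "e = e' + (\<Sum>b\<in>B. c b *\<^sub>C b)" by (simp add: e'_def)
  have step: "f h e + (\<Sum>b\<in>B. f (u b) b) = f h e' + (\<Sum>b\<in>B. f (u' b) b)"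
    by (subst e) (simp add: complex_bilinear_simps[OF f] u'_def sum.distrib)
  have step': "f' h e + (\<Sum>b\<in>B. f' (u b) b) = f' h e' + (\<Sum>b\<in>B. f' (u' b) b)"
    by (subst e) (simp add: complex_bilinear_simps[OF f'] u'_def sum.distrib)
  show ?case
  proof (cases "e' \<in> B")
    case True
    then have "e' = 0" using orth[of e'] by (simp add: cinner_self)
    then show ?thesis
      using B step step'
      by (intro exI[of _ B] exI[of _ u'])
        (simp add: p sums complex_bilinear_simps[OF f] complex_bilinear_simps[OF f'])
  next
    case False
    have orth': "cinner b e' = 0" if "b \<in> B" for b
      using orth[OF that] cinner_commute[of b e'] by simp
    have "(\<Sum>b\<in>insert e' B. f ((u'(e' := h)) b) b) = f h e' + (\<Sum>b\<in>B. f (u' b) b)"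
      "(\<Sum>b\<in>insert e' B. f' ((u'(e' := h)) b) b) = f' h e' + (\<Sum>b\<in>B. f' (u' b) b)"
      using False B(1) by (auto intro!: sum.cong)
    note ins = this
    show ?thesis
      using B step step' orth orth'
      by (intro exI[of _ "insert e' B"] exI[of _ "u'(e' := h)"])
        (simp add: p sums ins pairwise_insert del: fun_upd_apply)
  qed
qed

lemma norm_orthogonal_tensor_sum:
  assumes t: "hilbert_tensor t" and B: "finite B" "pairwise (\<lambda>x y. cinner x y = 0) B"
  shows "(norm (\<Sum>b\<in>B. t (u b) b))\<^sup>2 = (\<Sum>b\<in>B. (norm (u b))\<^sup>2 * (norm b)\<^sup>2)"
proof -
  have t_cinner: "cinner (t h e) (t h' e') = cinner h h' * cinner e e'" for h h' e e'
    using t by (simp add: hilbert_tensor_def)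
  have "complex_of_real ((norm (\<Sum>b\<in>B. t (u b) b))\<^sup>2)
      = (\<Sum>b\<in>B. \<Sum>b'\<in>B. cinner (u b') (u b) * cinner b' b)"
    by (simp add: cinner_self[symmetric] cinner_sum_left cinner_sum_right t_cinner del: of_real_power)
  also have "\<dots> = (\<Sum>b\<in>B. \<Sum>b'\<in>B. if b' = b then cinner (u b) (u b) * cinner b b else 0)"
    using B(2) by (intro sum.cong refl) (auto simp: pairwise_def)
  also have "\<dots> = complex_of_real (\<Sum>b\<in>B. (norm (u b))\<^sup>2 * (norm b)\<^sup>2)"
    using B(1) by (simp add: cinner_self)
  finally show ?thesis using of_real_eq_iff by blast
qed

lemma norm_tensor_left_le:
  fixes t :: "'h::chilbert_space \<Rightarrow> 'e::chilbert_space \<Rightarrow> 'k::chilbert_space"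
    and t' :: "'g::chilbert_space \<Rightarrow> 'e \<Rightarrow> 'l::chilbert_space"
  assumes t: "hilbert_tensor t" and t': "hilbert_tensor t'" and T: "T \<in> bop"
  shows "norm (\<Sum>(h, e)\<leftarrow>l. t' (blinfun_apply T h) e) \<le> norm T * norm (\<Sum>(h, e)\<leftarrow>l. t h e)"
proof -
  have "complex_bilinear (\<lambda>h e. t' (blinfun_apply T h) e)"
    using hilbert_tensor_bilinear[OF t'] T
    by (simp add: complex_bilinear_def blinfun.add_right bopD)
  then obtain B u where B: "finite B" "pairwise (\<lambda>x y. cinner x y = 0) B"
    and sums: "(\<Sum>(h, e)\<leftarrow>l. t h e) = (\<Sum>b\<in>B. t (u b) b)"
      "(\<Sum>(h, e)\<leftarrow>l. t' (blinfun_apply T h) e) = (\<Sum>b\<in>B. t' (blinfun_apply T (u b)) b)"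
    using orthogonal_rewriting[OF hilbert_tensor_bilinear[OF t], of _ l] by blast
  have "(norm (\<Sum>b\<in>B. t' (blinfun_apply T (u b)) b))\<^sup>2
      = (\<Sum>b\<in>B. (norm (blinfun_apply T (u b)))\<^sup>2 * (norm b)\<^sup>2)"
    by (rule norm_orthogonal_tensor_sum[OF t' B])
  also have "\<dots> \<le> (\<Sum>b\<in>B. (norm T * norm (u b))\<^sup>2 * (norm b)\<^sup>2)"
    by (intro sum_mono mult_right_mono power_mono norm_blinfun) auto
  also have "\<dots> = (norm T * norm (\<Sum>b\<in>B. t (u b) b))\<^sup>2"
    by (simp add: power_mult_distrib norm_orthogonal_tensor_sum[OF t B] sum_distrib_left mult.assoc)
  finally show ?thesis unfolding sums by (rule power2_le_imp_le) simp
qed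

lemma tensor_op_eqI:
  assumes t: "hilbert_tensor tE"
    and S: "\<And>h e. blinfun_apply S (tE h e) = tG (blinfun_apply T h) (blinfun_apply A e)"
  shows "tensor_op tE tG T A = S"
  unfolding tensor_op_def
proof (rule the_equality)
  fix S' assume S': "\<forall>h e. blinfun_apply S' (tE h e) = tG (blinfun_apply T h) (blinfun_apply A e)"
  let ?D = "{tE h e | h e. True}"
  have "blinfun_apply (S' - S) x = 0" for x
  proof (rule continuous_constant_on_closure[where f = "blinfun_apply (S' - S)" and S = "span ?D"])
    show "continuous_on (closure (span ?D)) (blinfun_apply (S' - S))"
      by (intro linear_continuous_on blinfun.bounded_linear_right)
    show "blinfun_apply (S' - S) y = 0" if "y \<in> span ?D" for y
    proof (rule linear_eq_0_on_span[of "blinfun_apply (S' - S)", OF _ _ that])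
      show "linear (blinfun_apply (S' - S))"
        by (intro bounded_linear.linear blinfun.bounded_linear_right)
      show "blinfun_apply (S' - S) d = 0" if "d \<in> ?D" for d
        using that by (auto simp: S S' blinfun.diff_left)
    qed
    show "x \<in> closure (span ?D)" using t by (simp add: hilbert_tensor_def)
  qed
  then show "S' = S" by (intro blinfun_eqI) (simp add: blinfun.diff_left)
qed (use S in blast)

text \<open>Boundedness is proved one factor at a time, as \<open>T \<otimes> A = (I \<otimes> A) (T \<otimes> I)\<close>: when both
  factors act at once, orthogonality of the second arguments is lost under \<open>A\<close>.\<close>

lemma tensor_op_apply:
  fixes T :: "'h::chilbert_space \<Rightarrow>\<^sub>L 'h"
  assumes tE: "hilbert_tensor tE" and tG: "hilbert_tensor tG" and T: "T \<in> bop" and A: "A \<in> bop"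
  shows "blinfun_apply (tensor_op tE tG T A) (tE h e) = tG (blinfun_apply T h) (blinfun_apply A e)"
proof -
  let ?v = "\<lambda>(h, e). tE h e" and ?w = "\<lambda>(h, e). tG (blinfun_apply T h) (blinfun_apply A e)"
  have bound: "norm (\<Sum>(h, e)\<leftarrow>l. tG (blinfun_apply T h) (blinfun_apply A e))
      \<le> norm A * norm T * norm (\<Sum>(h, e)\<leftarrow>l. tE h e)" for l
  proof -
    have "norm (\<Sum>(h, e)\<leftarrow>l. tG (blinfun_apply T h) (blinfun_apply A e))
        \<le> norm A * norm (\<Sum>(h, e)\<leftarrow>l. tE (blinfun_apply T h) e)"
      using norm_tensor_left_le[OF hilbert_tensor_swap[OF tE] hilbert_tensor_swap[OF tG] A,
          of "map (\<lambda>(h, e). (e, blinfun_apply T h)) l"]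
      by (simp add: comp_def case_prod_unfold)
    also have "\<dots> \<le> norm A * (norm T * norm (\<Sum>(h, e)\<leftarrow>l. tE h e))"
      by (intro mult_left_mono norm_tensor_left_le tE T) simp
    finally show ?thesis by (simp add: mult.assoc)
  qed
  have E: "tE (r *\<^sub>R h) e = r *\<^sub>R tE h e" for r h e
    by (simp add: scaleR_scaleC complex_bilinear_simps[OF hilbert_tensor_bilinear[OF tE]])
  have G: "tG (r *\<^sub>R h) e = r *\<^sub>R tG h e" for r h e
    by (simp add: scaleR_scaleC complex_bilinear_simps[OF hilbert_tensor_bilinear[OF tG]])
  have "range ?v = {tE h e | h e. True}" by auto
  then have "closure (span (range ?v)) = UNIV" using tE by (simp add: hilbert_tensor_def)
  moreover have "norm (\<Sum>(r, i)\<leftarrow>l. r *\<^sub>R ?w i) \<le> norm A * norm T * norm (\<Sum>(r, i)\<leftarrow>l. r *\<^sub>R ?v i)" for l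
    using bound[of "map (\<lambda>(r, h, e). (r *\<^sub>R h, e)) l"]
    by (simp add: comp_def case_prod_unfold E G blinfun.scaleR_right)
  ultimately obtain S where "\<And>i. blinfun_apply S (?v i) = ?w i"
    by (rule bounded_linear_by_generators) blast
  then have S: "blinfun_apply S (tE h e) = tG (blinfun_apply T h) (blinfun_apply A e)" for h e
    by (metis case_prod_conv)
  show ?thesis unfolding tensor_op_eqI[OF tE S] by (rule S)
qed

lemma tensor_op_scaleC:
  assumes tE: "hilbert_tensor tE" and tG: "hilbert_tensor tG" and T: "T \<in> bop" and A: "A \<in> bop"
  shows "tensor_op tE tG (scaleC_op c o\<^sub>L T) A = scaleC_op c o\<^sub>L tensor_op tE tG T A"
  by (rule tensor_op_eqI[OF tE])
    (simp add: tensor_op_apply[OF assms] complex_bilinear_simps[OF hilbert_tensor_bilinear[OF tG]])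


section \<open>A maximum principle with a uniform gap\<close>

text \<open>This is the Schwarz lemma for \<open>h\<close> followed by the Moebius map of the disc of radius \<open>M\<close>
  onto the unit disc that sends \<open>h 0\<close> to \<open>0\<close>. The estimate is weaker than that of Schwarz and
  Pick. It keeps what matters: for \<open>m < M\<close>, a bound below \<open>M\<close> that depends on \<open>h\<close> only
  through \<open>M\<close> and \<open>m\<close>.\<close>

lemma schwarz_pick_gap_strict:
  assumes hol: "h holomorphic_on ball 0 R" and R: "R > 0"
    and bound: "\<And>z. z \<in> ball 0 R \<Longrightarrow> cmod (h z) < M"
    and m: "cmod (h 0) \<le> m" "m \<le> M" and z: "cmod z < R"
  shows "(cmod (h z))\<^sup>2 \<le> M\<^sup>2 - (1 - (cmod z / R)\<^sup>2) * (M - m)\<^sup>2"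
proof -
  define a where "a = h 0"
  define t where "t = cmod z / R"
  have a: "cmod a < M" using bound[of 0] R by (simp add: a_def)
  then have M: "M > 0" using norm_ge_zero[of a] by linarith
  have t: "0 \<le> t" "t < 1" using z R by (auto simp: t_def)
  \<comment> \<open>the identity behind the fact that the Moebius map preserves the disc\<close>
  have ident: "(cmod (of_real (M\<^sup>2) - cnj a * w))\<^sup>2 - (M * cmod (w - a))\<^sup>2
      = (M\<^sup>2 - (cmod a)\<^sup>2) * (M\<^sup>2 - (cmod w)\<^sup>2)" for w
    by (simp add: power_mult_distrib cmod_power2) (simp add: algebra_simps power2_eq_square)
  have pos: "0 < (M\<^sup>2 - (cmod a)\<^sup>2) * (M\<^sup>2 - (cmod w)\<^sup>2)" if "cmod w < M" for w
    using a that by (intro mult_pos_pos) (simp_all add: power_strict_mono)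
  have lt: "M * cmod (w - a) < cmod (of_real (M\<^sup>2) - cnj a * w)" if "cmod w < M" for w
  proof (rule power2_less_imp_less)
    show "(M * cmod (w - a))\<^sup>2 < (cmod (of_real (M\<^sup>2) - cnj a * w))\<^sup>2"
      using ident[of w] pos[OF that] by linarith
  qed simp
  have ne: "of_real (M\<^sup>2) - cnj a * w \<noteq> 0" if "cmod w < M" for w
  proof -
    have "0 \<le> M * cmod (w - a)" using M by simp
    then have "0 < cmod (of_real (M\<^sup>2) - cnj a * w)" using lt[OF that] by linarith
    then show ?thesis by simp
  qed
  define \<phi> where "\<phi> \<zeta> = of_real M * (h (of_real R * \<zeta>) - a) / (of_real (M\<^sup>2) - cnj a * h (of_real R * \<zeta>))" for \<zeta>
  have in_ball: "of_real R * \<zeta> \<in> ball 0 R" if "cmod \<zeta> < 1" for \<zeta>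
    using that R by (simp add: norm_mult)
  have "(h \<circ> (\<lambda>\<zeta>. of_real R * \<zeta>)) holomorphic_on ball 0 1"
    using in_ball by (intro holomorphic_on_compose_gen[OF _ hol] holomorphic_intros) auto
  then have "(\<lambda>\<zeta>. h (of_real R * \<zeta>)) holomorphic_on ball 0 1" by (simp add: comp_def)
  then have "\<phi> holomorphic_on ball 0 1"
    unfolding \<phi>_def using ne bound in_ball by (intro holomorphic_intros) auto
  moreover have "cmod (\<phi> \<zeta>) < 1" if "cmod \<zeta> < 1" for \<zeta>
  proof -
    let ?w = "h (of_real R * \<zeta>)"
    have w: "cmod ?w < M" using bound in_ball that by blast
    have "0 < cmod (of_real (M\<^sup>2) - cnj a * ?w)" using ne[OF w] by simp
    then show ?thesis
      using lt[OF w] M by (simp add: \<phi>_def norm_divide norm_mult)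
  qed
  moreover have "\<phi> 0 = 0" by (simp add: \<phi>_def a_def)
  moreover have "cmod (z / of_real R) < 1" using z R by (simp add: norm_divide)
  ultimately have "cmod (\<phi> (z / of_real R)) \<le> cmod (z / of_real R)"
    using Schwarz_Lemma(1) by blast
  moreover define w where "w = h z"
  moreover have w: "cmod w < M" using bound z by (simp add: w_def)
  define D where "D = cmod (of_real (M\<^sup>2) - cnj a * w)"
  have D: "D > 0" using ne[OF w] by (simp add: D_def)
  ultimately have "M * cmod (w - a) \<le> t * D"
    using R M by (simp add: \<phi>_def t_def D_def w_def norm_divide norm_mult divide_le_eq)
  then have "(M * cmod (w - a))\<^sup>2 \<le> (t * D)\<^sup>2"
    using M by (intro power_mono) auto
  then have *: "(1 - t\<^sup>2) * D\<^sup>2 \<le> (M\<^sup>2 - (cmod a)\<^sup>2) * (M\<^sup>2 - (cmod w)\<^sup>2)"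
    using ident[of w] by (simp add: D_def algebra_simps power_mult_distrib)
  have "M * (M - m) \<le> M\<^sup>2 - cmod a * cmod w"
  proof -
    have "cmod a * cmod w \<le> m * M"
      using w m M by (intro mult_mono) (auto simp: a_def intro: order_trans[OF norm_ge_zero])
    then show ?thesis by (simp add: algebra_simps power2_eq_square)
  qed
  also have "\<dots> \<le> D"
    using norm_triangle_ineq2[of "of_real (M\<^sup>2)" "cnj a * w"] M
    by (simp add: D_def norm_mult norm_power)
  finally have "(M * (M - m))\<^sup>2 \<le> D\<^sup>2"
    using M m by (intro power_mono) auto
  then have "(1 - t\<^sup>2) * (M * (M - m))\<^sup>2 \<le> (1 - t\<^sup>2) * D\<^sup>2"
    using t by (intro mult_left_mono) (auto simp: power_le_one)
  also note *
  also have "(M\<^sup>2 - (cmod a)\<^sup>2) * (M\<^sup>2 - (cmod w)\<^sup>2) \<le> M\<^sup>2 * (M\<^sup>2 - (cmod w)\<^sup>2)"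
    using w by (intro mult_right_mono) (auto simp: power_mono)
  finally have "M\<^sup>2 * ((1 - t\<^sup>2) * (M - m)\<^sup>2) \<le> M\<^sup>2 * (M\<^sup>2 - (cmod w)\<^sup>2)"
    by (simp add: power_mult_distrib mult.left_commute)
  then show ?thesis using M by (simp add: t_def w_def)
qed

text \<open>With the weak bound \<open>M\<close>, the strict version holds for each \<open>x > M\<close>; let \<open>x\<close> tend to
  \<open>M\<close>.\<close>

lemma schwarz_pick_gap:
  assumes hol: "h holomorphic_on ball 0 R" and R: "R > 0"
    and bound: "\<And>z. z \<in> ball 0 R \<Longrightarrow> cmod (h z) \<le> M"
    and m: "cmod (h 0) \<le> m" "m \<le> M" and z: "cmod z < R"
  shows "(cmod (h z))\<^sup>2 \<le> M\<^sup>2 - (1 - (cmod z / R)\<^sup>2) * (M - m)\<^sup>2"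
proof (rule tendsto_lowerbound)
  show "((\<lambda>x. x\<^sup>2 - (1 - (cmod z / R)\<^sup>2) * (x - m)\<^sup>2)
      \<longlongrightarrow> M\<^sup>2 - (1 - (cmod z / R)\<^sup>2) * (M - m)\<^sup>2) (at_right M)"
    by (intro tendsto_intros)
  show "eventually (\<lambda>x. (cmod (h z))\<^sup>2 \<le> x\<^sup>2 - (1 - (cmod z / R)\<^sup>2) * (x - m)\<^sup>2) (at_right M)"
    using eventually_at_right_less[of M]
  proof eventually_elim
    case (elim x)
    show ?case
      using elim bound m z
      by (intro schwarz_pick_gap_strict[OF hol R]) (auto intro: le_less_trans)
  qed
qed simp

text \<open>The operator \<open>g 1\<close> need not attain its norm at a vector, so the maximum principle for a
  single coefficient \<open>\<langle>g(z) x, y\<rangle>\<close> does not suffice. The gap for unit vectors \<open>x\<close> and \<open>y\<close>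
  does not depend on \<open>x\<close> and \<open>y\<close>, and therefore passes to the supremum over them, which is the
  operator norm.\<close>

proposition operator_power_series_maximum:
  fixes Q :: "nat \<Rightarrow> ('a::chilbert_space \<Rightarrow>\<^sub>L 'b::chilbert_space)"
  assumes R: "R > 1"
    and g: "\<And>z. cmod z < R \<Longrightarrow> (\<lambda>k. scaleC_op (z ^ k) o\<^sub>L Q k) sums g z"
    and bound: "\<And>z. cmod z < R \<Longrightarrow> norm (g z) \<le> s"
    and less: "norm (g 0) < s"
  shows "norm (g 1) < s"
proof -
  define m where "m = norm (g 0)"
  define c where "c = s\<^sup>2 - (1 - (1 / R)\<^sup>2) * (s - m)\<^sup>2"
  have s: "s > 0" using less norm_ge_zero[of "g 0"] by linarith
  have coeff: "(cmod (cinner (blinfun_apply (g 1) x) y))\<^sup>2 \<le> c * (norm x * norm y)\<^sup>2" for x y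
  proof -
    define h where "h z = cinner (blinfun_apply (g z) x) y" for z
    have lin: "bounded_linear (\<lambda>T. cinner (blinfun_apply T x) y)"
      by (intro bounded_linear_compose[OF bounded_linear_cinner_left] blinfun.bounded_linear_left)
    have "(\<lambda>k. cinner (blinfun_apply (Q k) x) y * (z - 0) ^ k) sums h z" if "z \<in> ball 0 R" for z
      using bounded_linear.sums[OF lin g[of z]] that
      by (simp add: h_def cinner_scaleC_left mult.commute)
    then have hol: "h holomorphic_on ball 0 R" by (rule power_series_holomorphic)
    have h_le: "cmod (h z) \<le> norm (g z) * (norm x * norm y)" for z
    proof -
      have "cmod (h z) \<le> norm (blinfun_apply (g z) x) * norm y"
        unfolding h_def by (rule norm_cinner_le)
      also have "\<dots> \<le> norm (g z) * norm x * norm y"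
        by (intro mult_right_mono norm_blinfun) simp
      finally show ?thesis by (simp add: mult.assoc)
    qed
    have "(cmod (h 1))\<^sup>2 \<le> (s * (norm x * norm y))\<^sup>2
        - (1 - (cmod 1 / R)\<^sup>2) * (s * (norm x * norm y) - m * (norm x * norm y))\<^sup>2"
    proof (rule schwarz_pick_gap[OF hol])
      show "cmod (h z) \<le> s * (norm x * norm y)" if "z \<in> ball 0 R" for z
        using h_le[of z] mult_right_mono[OF bound[of z], of "norm x * norm y"] that by simp
      show "cmod (h 0) \<le> m * (norm x * norm y)" using h_le[of 0] by (simp add: m_def)
      show "m * (norm x * norm y) \<le> s * (norm x * norm y)"
        using less by (intro mult_right_mono) (auto simp: m_def)
    qed (use R in auto)
    also have "\<dots> = c * (norm x * norm y)\<^sup>2"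
      by (simp add: c_def power_mult_distrib left_diff_distrib[symmetric] del: left_diff_distrib)
        (simp add: algebra_simps)
    finally show ?thesis by (simp add: h_def)
  qed
  have "(1 - (1 / R)\<^sup>2) * (s - m)\<^sup>2 \<le> 1 * s\<^sup>2"
    using less s R by (intro mult_mono power_mono) (auto simp: m_def power_le_one)
  then have c0: "0 \<le> c" by (simp add: c_def)
  have "(norm (blinfun_apply (g 1) x))\<^sup>2 \<le> c * (norm x)\<^sup>2" for x
  proof (cases "blinfun_apply (g 1) x = 0")
    case True
    with c0 show ?thesis by simp
  next
    case False
    \<comment> \<open>the coefficient against \<open>g(1) x\<close> itself recovers \<open>\<parallel>g(1) x\<parallel>\<close>\<close>
    let ?y = "blinfun_apply (g 1) x"
    have "(norm ?y)\<^sup>2 * (norm ?y)\<^sup>2 \<le> (c * (norm x)\<^sup>2) * (norm ?y)\<^sup>2"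
      using coeff[of x ?y]
      by (simp add: cinner_self power_mult_distrib norm_mult norm_power mult.assoc
          flip: power2_eq_square)
    then show ?thesis by (rule mult_right_le_imp_le) (use False in simp)
  qed
  then have "norm (blinfun_apply (g 1) x) \<le> sqrt c * norm x" for x
    using real_le_rsqrt[of "norm (blinfun_apply (g 1) x)" "c * (norm x)\<^sup>2"] by (simp add: real_sqrt_mult)
  moreover have c: "c < s\<^sup>2"
  proof -
    have "0 < (1 - (1 / R)\<^sup>2) * (s - m)\<^sup>2"
      using R less by (intro mult_pos_pos) (auto simp: m_def power_less_one_iff)
    then show ?thesis by (simp add: c_def)
  qed
  moreover have "sqrt c < s" using c s by (simp add: real_less_lsqrt)
  ultimately show ?thesis
    using norm_blinfun_bound[of "sqrt c" "g 1"] c0 by simp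
qed

section \<open>The maximum principle for free holomorphic functions\<close>

theorem theorem1p5:
  fixes tE :: "'h::chilbert_space \<Rightarrow> 'e::chilbert_space \<Rightarrow> 'he::chilbert_space"
    and tG :: "'h \<Rightarrow> 'g::chilbert_space \<Rightarrow> 'hg::chilbert_space"
    and F :: "('n::countable \<Rightarrow> ('h \<Rightarrow>\<^sub>L 'h)) \<Rightarrow> ('he \<Rightarrow>\<^sub>L 'hg)"
  assumes "separable_hilbert TYPE('h)"
    and "infinite_dimensional TYPE('h)"
    and "hilbert_tensor tE"
    and "hilbert_tensor tG"
    and "free_holomorphic tE tG F"
    and "bounded_on_ball F"
    and "norm (F (\<lambda>_. 0)) < sup_norm F"
  shows "\<not> (\<exists>X0\<in>row_ball. norm (F X0) = sup_norm F)"
proof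
  note tE = assms(3) and tG = assms(4)
  assume "\<exists>X0\<in>row_ball. norm (F X0) = sup_norm F"
  then obtain X where X: "X \<in> row_ball" and max: "norm (F X) = sup_norm F" by blast
  obtain A where A: "\<And>\<alpha>. A \<alpha> \<in> bop"
    and series: "\<And>Y. Y \<in> row_ball \<Longrightarrow> \<exists>P.
      (\<forall>k. sot_has_sum (\<lambda>\<alpha>. tensor_op tE tG (word_op Y \<alpha>) (A \<alpha>)) (P k) {\<alpha>. length \<alpha> = k}) \<and>
      P sums F Y"
    using assms(5) unfolding free_holomorphic_def by blast
  obtain Q where Q: "\<And>k. sot_has_sum (\<lambda>\<alpha>. tensor_op tE tG (word_op X \<alpha>) (A \<alpha>)) (Q k) {\<alpha>. length \<alpha> = k}"
    using series[OF X] by blast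
  have bop: "X i \<in> bop" for i using X by (simp add: row_ball_def)
  have r: "0 \<le> row_norm X" "row_norm X < 1" using X by (auto simp: row_ball_def row_norm_def)
  \<comment> \<open>\<open>1 < R\<close> and \<open>R * row_norm X < 1\<close>: the disc reaches beyond \<open>X\<close> but stays in the ball\<close>
  define R where "R = 2 / (1 + row_norm X)"
  have R: "R > 1" "R * row_norm X < 1" using r by (auto simp: R_def field_simps)
  define Y where "Y z = (\<lambda>i. scaleC_op z o\<^sub>L X i)" for z
  have Y: "Y z \<in> row_ball" if "cmod z < R" for z
  proof -
    have "cmod z * row_norm X \<le> R * row_norm X" using that r by (intro mult_right_mono) auto
    then show ?thesis using R unfolding Y_def by (intro row_ball_scaleC X) auto
  qed
  have sums: "(\<lambda>k. scaleC_op (z ^ k) o\<^sub>L Q k) sums F (Y z)" if z: "cmod z < R" for z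
  proof -
    obtain P where P: "\<And>k. sot_has_sum (\<lambda>\<alpha>. tensor_op tE tG (word_op (Y z) \<alpha>) (A \<alpha>)) (P k) {\<alpha>. length \<alpha> = k}"
      "P sums F (Y z)"
      using series[OF Y[OF z]] by blast
    have "P k = scaleC_op (z ^ k) o\<^sub>L Q k" for k
    proof (rule sot_has_sum_unique[OF P(1)])
      have "tensor_op tE tG (word_op (Y z) \<alpha>) (A \<alpha>)
          = scaleC_op (z ^ k) o\<^sub>L tensor_op tE tG (word_op X \<alpha>) (A \<alpha>)" if "length \<alpha> = k" for \<alpha>
        using that tensor_op_scaleC[OF tE tG word_op_bop[OF bop] A]
        by (simp add: Y_def word_op_scaleC[OF bop])
      then show "sot_has_sum (\<lambda>\<alpha>. tensor_op tE tG (word_op (Y z) \<alpha>) (A \<alpha>))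
          (scaleC_op (z ^ k) o\<^sub>L Q k) {\<alpha>. length \<alpha> = k}"
        using sot_has_sum_compose_left[OF Q[of k], of "scaleC_op (z ^ k)"]
        by (subst sot_has_sum_cong) auto
    qed
    then have "P = (\<lambda>k. scaleC_op (z ^ k) o\<^sub>L Q k)" by (rule ext)
    then show ?thesis using P(2) by simp
  qed
  have "norm (F (Y 1)) < sup_norm F"
  proof (rule operator_power_series_maximum[OF R(1) sums])
    show "norm (F (Y z)) \<le> sup_norm F" if "cmod z < R" for z
      using assms(6) Y[OF that] unfolding sup_norm_def bounded_on_ball_def
      by (intro cSUP_upper) auto
    have "Y 0 = (\<lambda>_. 0)" by (auto simp: Y_def intro!: blinfun_eqI)
    then show "norm (F (Y 0)) < sup_norm F" using assms(7) by simp
  qed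
  moreover have "Y 1 = X" by (auto simp: Y_def intro!: blinfun_eqI)
  ultimately show False using max by simp
qed

end
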